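(* The map $\varphi: PL_\delta(\mathbb{R}) \to QI(\mathbb{R})$ defined by $\varphi(f)=[f]$ (which is a well-defined group homomorphism) is surjective.
   Context: $\mathbb{R}$ carries its usual metric. A map $f:X\to X'$ between metric spaces $(X,d)$, $(X',d')$, not assumed continuous, is a $C$-quasi-isometric embedding, where $C>1$, if $C^{-1}d(x,y)-C\le d'(f(x),f(y))\le C\,d(x,y)+C$ for all $x,y\in X$. It is a $C$-quasi-isometry if moreover every $x'\in X'$ is within distance $C$ of the image of $f$. It is a quasi-isometry if it is a $C$-quasi-isometry for some $C>1$. Two maps $f,g:X\to X$ are equivalent if there is a constant $M$ with $d(f(x),g(x))\le M$ for all $x\in X$. $[f]$ denotes the equivalence class of a quasi-isometry $f:X\to X$, and $QI(X)$ is the group of all equivalence classes of quasi-isometries of $X$, with product $[f]\cdot[g]=[f\circ g]$. For a piecewise-linear homeomorphism $f$ of $\mathbb{R}$ (the set of break points meets each bounded interval in a finite set), let $B(f)$ be the set of points where $f$ is not differentiable and $\Lambda(f)=\{f'(t): t\in\mathbb{R}\setminus B(f)\}$ its set of slopes. A set $\Lambda$ of non-zero real numbers is called bounded if there is $M>1$ with $M^{-1}<|\lambda|<M$ for all $\lambda\in\Lambda$. $PL_\delta(\mathbb{R})$ is the group, under composition, of all piecewise-linear homeomorphisms $f$ of $\mathbb{R}$ (orientation preserving or reversing) such that $\Lambda(f)$ is bounded. Each such $f$ is a quasi-isometry. *)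

theory Defs
  imports "HOL-Analysis.Analysis" "HOL-Algebra.Group"
begin

definition qi_embedding_const :: "real \<Rightarrow> ('a::metric_space \<Rightarrow> 'b::metric_space) \<Rightarrow> bool" where
  "qi_embedding_const C f \<longleftrightarrow> C > 1 \<and>
     (\<forall>x y. dist x y / C - C \<le> dist (f x) (f y) \<and> dist (f x) (f y) \<le> C * dist x y + C)"

definition quasi_isometry_const :: "real \<Rightarrow> ('a::metric_space \<Rightarrow> 'b::metric_space) \<Rightarrow> bool" where
  "quasi_isometry_const C f \<longleftrightarrow> qi_embedding_const C f \<and> (\<forall>x'. \<exists>x. dist x' (f x) \<le> C)"

definition quasi_isometry :: "('a::metric_space \<Rightarrow> 'b::metric_space) \<Rightarrow> bool" where
  "quasi_isometry f \<longleftrightarrow> (\<exists>C>1. quasi_isometry_const C f)"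

definition qi_rel :: "(('a::metric_space \<Rightarrow> 'a) \<times> ('a \<Rightarrow> 'a)) set" where
  "qi_rel = {(f, g). quasi_isometry f \<and> quasi_isometry g \<and> (\<exists>M. \<forall>x. dist (f x) (g x) \<le> M)}"

definition qi_class :: "('a::metric_space \<Rightarrow> 'a) \<Rightarrow> ('a \<Rightarrow> 'a) set" where
  "qi_class f = qi_rel `` {f}"

text \<open>The product of two classes is the union of the classes of \<open>f \<circ> g\<close> over all representatives
  \<open>f\<close>, \<open>g\<close>; by lemma \<open>QI_mult_class\<close> below, this union is the single class \<open>qi_class (f \<circ> g)\<close>.\<close>

definition QI :: "('a::metric_space \<Rightarrow> 'a) set monoid" where
  "QI = \<lparr>carrier = {f. quasi_isometry f} // qi_rel,
         mult = (\<lambda>A B. \<Union>f\<in>A. \<Union>g\<in>B. qi_class (f \<circ> g)),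
         one = qi_class id\<rparr>"

definition break_points :: "(real \<Rightarrow> real) \<Rightarrow> real set" where
  "break_points f = {x. \<not> f differentiable (at x)}"

definition slopes :: "(real \<Rightarrow> real) \<Rightarrow> real set" where
  "slopes f = deriv f ` (- break_points f)"

definition pl_homeomorphism :: "(real \<Rightarrow> real) \<Rightarrow> bool" where
  "pl_homeomorphism f \<longleftrightarrow>
     (\<exists>g. homeomorphism UNIV UNIV f g) \<and>
     (\<forall>a b. finite (break_points f \<inter> {a..b})) \<and>
     (\<forall>a b. {a<..<b} \<inter> break_points f = {} \<longrightarrow> (\<exists>m c. \<forall>x\<in>{a<..<b}. f x = m * x + c))"

text \<open>Boundedness of a set of slopes is multiplicative: bounded and bounded away from \<open>0\<close>.\<close>

definition bounded_slopes :: "real set \<Rightarrow> bool" where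
  "bounded_slopes L \<longleftrightarrow> (\<exists>M>1. \<forall>l\<in>L. 1 / M < \<bar>l\<bar> \<and> \<bar>l\<bar> < M)"

definition PL_delta :: "(real \<Rightarrow> real) monoid" where
  "PL_delta = \<lparr>carrier = {f. pl_homeomorphism f \<and> bounded_slopes (slopes f)},
               mult = (\<circ>), one = id\<rparr>"

lemma equiv_qi_rel: "equiv {f :: 'a::metric_space \<Rightarrow> 'a. quasi_isometry f} qi_rel"
proof (rule equivI)
  show "qi_rel \<subseteq> {f :: 'a \<Rightarrow> 'a. quasi_isometry f} \<times> {f. quasi_isometry f}"
    by (auto simp: qi_rel_def)
  show "refl_on {f :: 'a \<Rightarrow> 'a. quasi_isometry f} qi_rel"
    by (auto simp: refl_on_def qi_rel_def intro: exI[of _ 0])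
  show "sym (qi_rel :: (('a \<Rightarrow> 'a) \<times> _) set)"
    by (auto simp: sym_def qi_rel_def dist_commute)
  show "trans (qi_rel :: (('a \<Rightarrow> 'a) \<times> _) set)"
  proof (rule transI)
    fix f g h :: "'a \<Rightarrow> 'a"
    assume "(f, g) \<in> qi_rel" "(g, h) \<in> qi_rel"
    then obtain M N where q: "quasi_isometry f" "quasi_isometry h"
      and M: "\<And>x. dist (f x) (g x) \<le> M" and N: "\<And>x. dist (g x) (h x) \<le> N"
      by (auto simp: qi_rel_def)
    have "dist (f x) (h x) \<le> M + N" for x
      using M[of x] N[of x] dist_triangle[of "f x" "h x" "g x"] by linarith
    with q show "(f, h) \<in> qi_rel" by (auto simp: qi_rel_def)
  qed
qed

lemma quasi_isometry_comp:
  fixes f :: "'b::metric_space \<Rightarrow> 'c::metric_space" and g :: "'a::metric_space \<Rightarrow> 'b"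
  assumes "quasi_isometry f" "quasi_isometry g"
  shows "quasi_isometry (f \<circ> g)"
proof -
  obtain C where C: "C > 1" and f1: "\<And>x y. dist x y / C - C \<le> dist (f x) (f y)"
    and f2: "\<And>x y. dist (f x) (f y) \<le> C * dist x y + C" and f3: "\<And>z. \<exists>x. dist z (f x) \<le> C"
    using assms(1) by (auto simp: quasi_isometry_def quasi_isometry_const_def qi_embedding_const_def)
  obtain D where D: "D > 1" and g1: "\<And>x y. dist x y / D - D \<le> dist (g x) (g y)"
    and g2: "\<And>x y. dist (g x) (g y) \<le> D * dist x y + D" and g3: "\<And>z. \<exists>x. dist z (g x) \<le> D"
    using assms(2) by (auto simp: quasi_isometry_def quasi_isometry_const_def qi_embedding_const_def)
  define K where "K = C * D + 2 * C + D"
  have CD: "C * D > 0" using C D by simp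
  have K1: "K > 1" unfolding K_def using C D CD by linarith
  have KCD: "C * D \<le> K" unfolding K_def using C D by linarith
  have "dist x y / K - K \<le> dist (f (g x)) (f (g y))" for x y
  proof -
    have "dist x y / K \<le> dist x y / (C * D)" using KCD CD by (intro divide_left_mono) auto
    also have "\<dots> = (dist x y / D) / C" by simp
    also have "\<dots> \<le> (dist (g x) (g y) + D) / C"
      using g1[of x y] C by (intro divide_right_mono) auto
    also have "\<dots> = dist (g x) (g y) / C + D / C" by (simp add: add_divide_distrib)
    also have "\<dots> \<le> dist (f (g x)) (f (g y)) + C + D"
    proof -
      have "D / C \<le> D" using C D by (simp add: field_simps)
      then show ?thesis using f1[of "g x" "g y"] by linarith
    qed
    also have "\<dots> \<le> dist (f (g x)) (f (g y)) + K" unfolding K_def using C D CD by linarith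
    finally show ?thesis by simp
  qed
  moreover have "dist (f (g x)) (f (g y)) \<le> K * dist x y + K" for x y
  proof -
    have "dist (f (g x)) (f (g y)) \<le> C * (D * dist x y + D) + C"
      using f2[of "g x" "g y"] mult_left_mono[OF g2[of x y], of C] C by linarith
    also have "\<dots> = (C * D) * dist x y + (C * D + C)" by (simp add: algebra_simps)
    also have "\<dots> \<le> K * dist x y + K"
      using C D by (intro add_mono mult_right_mono KCD) (auto simp: K_def)
    finally show ?thesis .
  qed
  moreover have "\<exists>x. dist z (f (g x)) \<le> K" for z
  proof -
    obtain y where y: "dist z (f y) \<le> C" using f3 by blast
    obtain x where x: "dist y (g x) \<le> D" using g3 by blast
    have "dist (f y) (f (g x)) \<le> C * D + C"
      using f2[of y "g x"] mult_left_mono[OF x, of C] C by linarith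
    then have "dist z (f (g x)) \<le> C + (C * D + C)"
      using y dist_triangle[of z "f (g x)" "f y"] by linarith
    then show ?thesis using D by (intro exI[of _ x]) (simp add: K_def)
  qed
  ultimately show ?thesis using K1
    by (auto simp: quasi_isometry_def quasi_isometry_const_def qi_embedding_const_def)
qed

lemma qi_rel_comp:
  assumes "(f, f') \<in> qi_rel" "(g, g') \<in> qi_rel"
  shows "(f \<circ> g, f' \<circ> g') \<in> qi_rel"
proof -
  have q: "quasi_isometry f" "quasi_isometry f'" "quasi_isometry g" "quasi_isometry g'"
    using assms by (auto simp: qi_rel_def)
  obtain M N where M: "\<And>x. dist (f x) (f' x) \<le> M" and N: "\<And>x. dist (g x) (g' x) \<le> N"
    using assms by (auto simp: qi_rel_def)
  obtain C where C: "C > 1" and f2: "\<And>x y. dist (f x) (f y) \<le> C * dist x y + C"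
    using q(1) by (auto simp: quasi_isometry_def quasi_isometry_const_def qi_embedding_const_def)
  have "dist (f (g x)) (f' (g' x)) \<le> (C * N + C) + M" for x
    using f2[of "g x" "g' x"] mult_left_mono[OF N[of x], of C] C M[of "g' x"]
      dist_triangle[of "f (g x)" "f' (g' x)" "f (g' x)"] by linarith
  with q show ?thesis by (auto simp: qi_rel_def quasi_isometry_comp)
qed

lemma QI_mult_class:
  assumes "quasi_isometry f" "quasi_isometry g"
  shows "qi_class f \<otimes>\<^bsub>QI\<^esub> qi_class g = qi_class (f \<circ> g)"
proof -
  have cls: "qi_class (f' \<circ> g') = qi_class (f \<circ> g)" if "f' \<in> qi_class f" "g' \<in> qi_class g" for f' g'
  proof -
    have "(f \<circ> g, f' \<circ> g') \<in> qi_rel"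
      using that by (intro qi_rel_comp) (auto simp: qi_class_def)
    then show ?thesis
      unfolding qi_class_def by (rule equiv_class_eq[OF equiv_qi_rel, symmetric])
  qed
  have "f \<in> qi_class f" "g \<in> qi_class g"
    using assms by (auto simp: qi_class_def qi_rel_def)
  then have "(\<Union>f'\<in>qi_class f. \<Union>g'\<in>qi_class g. qi_class (f' \<circ> g')) = qi_class (f \<circ> g)"
    using cls by blast
  then show ?thesis by (simp add: QI_def)
qed

end

theory Submission
  imports Defs
begin

text \<open>The substance of the theorem is surjectivity: every quasi-isometry \<open>f\<close> of the line is at bounded
  distance from a piecewise-linear homeomorphism with bounded slopes.  A quasi-isometry need not be
  continuous, but at large scale it behaves like an injective continuous map.  It satisfies an
  intermediate value theorem up to a bounded error (\<open>coarse_intermediate_value\<close>), while points far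
  apart have images further apart than that error; hence it cannot reverse its direction on a
  sufficiently wide grid \<open>L * \<int>\<close> (\<open>qi_embedding_between\<close>).  The values of \<open>f\<close> on the grid are
  therefore strictly monotone, with steps bounded above and bounded away from \<open>0\<close>, and linear
  interpolation between them yields a homeomorphism whose slopes are the steps divided by \<open>L\<close>
  (\<open>interp_PL_delta\<close>).  Neither \<open>f\<close> nor the interpolant moves far within one cell, so they stay at
  bounded distance (\<open>PL_delta_near_quasi_isometry\<close>).

  The algebraic claims rest on a local description of the piecewise-linear homeomorphisms with
  bounded slopes: they are the homeomorphisms that, on either side of each point, are affine near
  that point, with slopes in a fixed range (\<open>PL_deltaI\<close>, \<open>PL_deltaD\<close>).  In this form, stability under
  composition and inversion is the chain rule and the inversion of an affine formula.  Integrating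
  the slope bounds shows that these maps are bilipschitz, hence quasi-isometries.  The group axioms
  for the classes of quasi-isometries then come for free: the classes are the image of a group under
  a multiplicative map, by surjectivity.\<close>

section \<open>Germs of piecewise-linear maps\<close>

text \<open>A piecewise-linear map is described by what it does near each point: it is affine on each side of
  the point, with a left slope and a right slope.  This condition is purely local, so that it passes
  through compositions and inverses without any bookkeeping of break points.  The filter of
  neighbourhoods includes the point itself, where the equation holds trivially.\<close>

definition pl_germ :: "(real \<Rightarrow> real) \<Rightarrow> real \<Rightarrow> real \<Rightarrow> real \<Rightarrow> bool" where
  "pl_germ f l r x \<longleftrightarrow> (\<forall>\<^sub>F y in nhds x. f y = f x + (if y \<le> x then l else r) * (y - x))"

definition slope_within :: "real \<Rightarrow> real \<Rightarrow> bool" where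
  "slope_within M s \<longleftrightarrow> 1 / M < \<bar>s\<bar> \<and> \<bar>s\<bar> < M"

definition bounded_germs :: "real \<Rightarrow> (real \<Rightarrow> real) \<Rightarrow> bool" where
  "bounded_germs M f \<longleftrightarrow>
     (\<forall>x. \<exists>l r. slope_within M l \<and> slope_within M r \<and> pl_germ f l r x)"

lemma bounded_germsD:
  "bounded_germs M f \<Longrightarrow> \<exists>l r. slope_within M l \<and> slope_within M r \<and> pl_germ f l r x"
  unfolding bounded_germs_def by (rule spec)

lemma slope_within_mult:
  assumes "M > 0" "N > 0" "slope_within M s" "slope_within N t"
  shows "slope_within (M * N) (s * t)"
proof -
  have "1 / M * (1 / N) < \<bar>s\<bar> * \<bar>t\<bar>" "\<bar>s\<bar> * \<bar>t\<bar> < M * N"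
    using assms by (intro mult_strict_mono; auto simp: slope_within_def)+
  then show ?thesis by (simp add: slope_within_def abs_mult)
qed

lemma slope_within_inverse:
  assumes "M > 0" "slope_within M s"
  shows "slope_within M (1 / s)" "s \<noteq> 0"
proof -
  have s: "1 / M < \<bar>s\<bar>" "\<bar>s\<bar> < M" using assms by (auto simp: slope_within_def)
  have "0 < 1 / M" using assms by simp
  then have p: "\<bar>s\<bar> > 0" using s by linarith
  then show "s \<noteq> 0" by simp
  show "slope_within M (1 / s)"
    using s p assms(1) by (auto simp: slope_within_def abs_divide field_simps)
qed

lemma pl_germE:
  assumes "pl_germ f l r x"
  obtains e where "e > 0" "\<And>y. \<bar>y - x\<bar> < e \<Longrightarrow> f y = f x + (if y \<le> x then l else r) * (y - x)"
  using assms unfolding pl_germ_def eventually_nhds_metric dist_real_def by blast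

lemma pl_germI:
  assumes "e > 0" "\<And>y. \<bar>y - x\<bar> < e \<Longrightarrow> f y = f x + (if y \<le> x then l else r) * (y - x)"
  shows "pl_germ f l r x"
  using assms unfolding pl_germ_def eventually_nhds_metric dist_real_def by blast

lemma pl_germ_isCont:
  assumes "pl_germ f l r x"
  shows "isCont f x"
proof -
  have "((\<lambda>y. (if y \<le> x then l else r) * (y - x)) \<longlongrightarrow> 0) (nhds x)"
  proof (rule Lim_null_comparison)
    show "\<forall>\<^sub>F y in nhds x. norm ((if y \<le> x then l else r) * (y - x)) \<le> max \<bar>l\<bar> \<bar>r\<bar> * \<bar>y - x\<bar>"
      by (intro always_eventually) (auto simp: abs_mult intro!: mult_right_mono)
    have "((\<lambda>y. max \<bar>l\<bar> \<bar>r\<bar> * \<bar>y - x\<bar>) \<longlongrightarrow> max \<bar>l\<bar> \<bar>r\<bar> * \<bar>x - x\<bar>) (nhds x)"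
      by (intro tendsto_intros filterlim_ident)
    then show "((\<lambda>y. max \<bar>l\<bar> \<bar>r\<bar> * \<bar>y - x\<bar>) \<longlongrightarrow> 0) (nhds x)" by simp
  qed
  from tendsto_add[OF tendsto_const[of "f x"] this]
  have "((\<lambda>y. f x + (if y \<le> x then l else r) * (y - x)) \<longlongrightarrow> f x) (nhds x)" by simp
  then have "(f \<longlongrightarrow> f x) (nhds x)"
    by (rule Lim_transform_eventually)
      (use assms in \<open>auto simp: pl_germ_def elim: eventually_mono\<close>)
  then show ?thesis
    by (simp add: isCont_def tendsto_nhds_iff)
qed

lemma bounded_germs_continuous:
  "bounded_germs M f \<Longrightarrow> continuous_on UNIV f"
  using bounded_germsD pl_germ_isCont by (blast intro: continuous_at_imp_continuous_on)

section \<open>Composition and inversion of germs\<close>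

text \<open>An injective continuous map cannot fold at a point, and opposite signs of the two slopes would be
  a fold.\<close>

lemma germ_slopes_same_sign:
  assumes hom: "homeomorphism UNIV UNIV f g" and germ: "pl_germ f l r x" and nz: "l \<noteq> 0" "r \<noteq> 0"
  shows "l > 0 \<and> r > 0 \<or> l < 0 \<and> r < 0"
proof -
  obtain e where e: "e > 0" "\<And>y. \<bar>y - x\<bar> < e \<Longrightarrow> f y = f x + (if y \<le> x then l else r) * (y - x)"
    using pl_germE[OF germ] by blast
  define t where "t = e / 2"
  have t: "t > 0" "t < e" using e by (auto simp: t_def)
  have "inj f" using hom by (metis homeomorphism_def UNIV_I injI)
  then have "f (x - t) < f x \<and> f x < f (x + t) \<or> f (x + t) < f x \<and> f x < f (x - t)"
    using hom t by (intro continuous_inj_imp_mono)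
      (auto simp: homeomorphism_def intro: continuous_on_subset inj_on_subset)
  moreover have "f (x - t) = f x - l * t" "f (x + t) = f x + r * t"
    using e(2)[of "x - t"] e(2)[of "x + t"] t by auto
  ultimately have "l * t > 0 \<and> r * t > 0 \<or> l * t < 0 \<and> r * t < 0" by linarith
  then show ?thesis using t by (auto simp: zero_less_mult_iff mult_less_0_iff)
qed

text \<open>The chain rule for germs.  Which one-sided slope of \<open>f\<close> is met at \<open>g x\<close> depends on the sign of
  the slope of \<open>g\<close>: a negative slope exchanges the two sides.  Only the set of values matters for
  bounds on slopes, so that the conclusion leaves the choice open.\<close>

lemma pl_germ_compose:
  assumes g: "pl_germ g l r x" and f: "pl_germ f l' r' (g x)"
  shows "\<exists>a\<in>{l', r'}. \<exists>b\<in>{l', r'}. pl_germ (f \<circ> g) (a * l) (b * r) x"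
proof -
  define a b where "a = (if l \<ge> 0 then l' else r')" and "b = (if r > 0 then r' else l')"
  have "filterlim g (nhds (g x)) (nhds x)"
    using pl_germ_isCont[OF g] by (simp add: isCont_def tendsto_nhds_iff)
  with f have "\<forall>\<^sub>F y in nhds x. f (g y) = f (g x) + (if g y \<le> g x then l' else r') * (g y - g x)"
    unfolding pl_germ_def by (rule eventually_compose_filterlim)
  moreover have "\<forall>\<^sub>F y in nhds x. g y = g x + (if y \<le> x then l else r) * (y - x)"
    using g by (simp add: pl_germ_def)
  ultimately have "\<forall>\<^sub>F y in nhds x. (f \<circ> g) y = (f \<circ> g) x + (if y \<le> x then a * l else b * r) * (y - x)"
  \<comment> \<open>When the slope of \<open>g\<close> vanishes, \<open>g y = g x\<close> and the choice of \<open>a\<close> or \<open>b\<close> is immaterial.\<close>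
  proof eventually_elim
    case (elim y)
    define m where "m = (if y \<le> x then l else r)"
    have gy: "g y - g x = m * (y - x)" using elim(2) by (simp add: m_def)
    have "(if g y \<le> g x then l' else r') * (g y - g x)
        = (if y \<le> x then a * l else b * r) * (y - x)"
    proof (cases "g y = g x")
      case True
      with gy have "m * (y - x) = 0" by simp
      then show ?thesis using True by (auto simp: m_def split: if_splits)
    next
      case False
      then have "m * (y - x) \<noteq> 0" using gy by (metis right_minus_eq)
      moreover have "g y \<le> g x \<longleftrightarrow> m * (y - x) \<le> 0" using gy by linarith
      ultimately show ?thesis
        unfolding gy by (cases "y \<le> x") (auto simp: m_def a_def b_def mult_le_0_iff)
    qed
    with elim(1) show ?case by simp
  qed
  then have "pl_germ (f \<circ> g) (a * l) (b * r) x" by (simp add: pl_germ_def)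
  moreover have "a \<in> {l', r'}" "b \<in> {l', r'}" by (auto simp: a_def b_def)
  ultimately show ?thesis by blast
qed

lemma bounded_germs_compose:
  assumes "M > 0" "N > 0" "bounded_germs M f" "bounded_germs N g"
  shows "bounded_germs (M * N) (f \<circ> g)"
  unfolding bounded_germs_def
proof
  fix x
  obtain l r where g: "slope_within N l" "slope_within N r" "pl_germ g l r x"
    using bounded_germsD[OF assms(4)] by blast
  obtain l' r' where f: "slope_within M l'" "slope_within M r'" "pl_germ f l' r' (g x)"
    using bounded_germsD[OF assms(3)] by blast
  obtain a b where "a \<in> {l', r'}" "b \<in> {l', r'}" "pl_germ (f \<circ> g) (a * l) (b * r) x"
    using pl_germ_compose[OF g(3) f(3)] by blast
  then show "\<exists>l r. slope_within (M * N) l \<and> slope_within (M * N) r \<and> pl_germ (f \<circ> g) l r x"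
    using f g assms by (intro exI[of _ "a * l"] exI[of _ "b * r"]) (auto intro!: slope_within_mult)
qed

text \<open>Inverting the affine formula on each side gives the reciprocal slopes.  The two sides are kept or
  exchanged together, because both slopes have the same sign.\<close>

lemma bounded_germs_inverse:
  assumes M: "M > 0" and hom: "homeomorphism UNIV UNIV f g" and f: "bounded_germs M f"
  shows "bounded_germs M g"
  unfolding bounded_germs_def
proof
  fix z
  have fg: "f (g w) = w" "g (f w) = w" for w using hom by (auto simp: homeomorphism_def)
  obtain l r where lr: "slope_within M l" "slope_within M r" and germ: "pl_germ f l r (g z)"
    using bounded_germsD[OF f] by blast
  note nz = slope_within_inverse(2)[OF M lr(1)] slope_within_inverse(2)[OF M lr(2)]
  have "isCont g z"
    using hom by (auto simp: homeomorphism_def continuous_on_eq_continuous_at)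
  then have "filterlim g (nhds (g z)) (nhds z)" by (simp add: isCont_def tendsto_nhds_iff)
  with germ have ev:
    "\<forall>\<^sub>F w in nhds z. f (g w) = f (g z) + (if g w \<le> g z then l else r) * (g w - g z)"
    unfolding pl_germ_def by (rule eventually_compose_filterlim)
  consider "l > 0" "r > 0" | "l < 0" "r < 0"
    using germ_slopes_same_sign[OF hom germ nz] by blast
  then have "pl_germ g (1 / l) (1 / r) z \<or> pl_germ g (1 / r) (1 / l) z"
  proof cases
    case 1
    from ev have "\<forall>\<^sub>F w in nhds z. g w = g z + (if w \<le> z then 1 / l else 1 / r) * (w - z)"
    proof eventually_elim
      case (elim w)
      then have w: "w - z = (if g w \<le> g z then l else r) * (g w - g z)" by (simp add: fg)
      have "w - z \<le> 0 \<longleftrightarrow> g w - g z \<le> 0"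
        unfolding w using 1 by (auto simp: mult_le_0_iff)
      then show ?case using w nz by (simp split: if_splits)
    qed
    then show ?thesis by (simp add: pl_germ_def)
  next
    case 2
    from ev have "\<forall>\<^sub>F w in nhds z. g w = g z + (if w \<le> z then 1 / r else 1 / l) * (w - z)"
    proof eventually_elim
      case (elim w)
      then have w: "w - z = (if g w \<le> g z then l else r) * (g w - g z)" by (simp add: fg)
      show ?case
      proof (cases "w = z")
        case False
        then have "g w \<noteq> g z" using w by auto
        moreover have "w - z \<le> 0 \<longleftrightarrow> g w - g z \<ge> 0"
          unfolding w using 2 by (auto simp: mult_le_0_iff)
        ultimately show ?thesis using w nz by (simp split: if_splits)
      qed simp
    qed
    then show ?thesis by (simp add: pl_germ_def)
  qed
  then show "\<exists>l r. slope_within M l \<and> slope_within M r \<and> pl_germ g l r z"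
    using slope_within_inverse(1)[OF M] lr by blast
qed

section \<open>The group of piecewise-linear homeomorphisms with bounded slopes\<close>

lemma pl_germ_has_derivative_nearby:
  assumes "pl_germ f l r x"
  obtains e where "e > 0"
    "\<And>y. x - e < y \<Longrightarrow> y < x \<Longrightarrow> (f has_real_derivative l) (at y)"
    "\<And>y. x < y \<Longrightarrow> y < x + e \<Longrightarrow> (f has_real_derivative r) (at y)"
proof -
  obtain e where e: "e > 0" "\<And>y. \<bar>y - x\<bar> < e \<Longrightarrow> f y = f x + (if y \<le> x then l else r) * (y - x)"
    using pl_germE[OF assms] by blast
  have d: "((\<lambda>y. f x + m * (y - x)) has_real_derivative m) (at y)" for m y
    by (auto intro!: derivative_eq_intros)
  show thesis
  proof (rule that[OF e(1)])
    fix y assume y: "x - e < y" "y < x"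
    show "(f has_real_derivative l) (at y)"
    proof (rule has_field_derivative_transform_within_open[OF d, where S = "{x - e<..<x}"])
      show "f x + l * (z - x) = f z" if "z \<in> {x - e<..<x}" for z
        using that e(2)[of z] by auto
    qed (use y in auto)
  next
    fix y assume y: "x < y" "y < x + e"
    show "(f has_real_derivative r) (at y)"
    proof (rule has_field_derivative_transform_within_open[OF d, where S = "{x<..<x + e}"])
      show "f x + r * (z - x) = f z" if "z \<in> {x<..<x + e}" for z
        using that e(2)[of z] by auto
    qed (use y in auto)
  qed
qed

text \<open>At a point of differentiability the one-sided derivatives agree, so the germ is that of an affine
  map: there is no break there.\<close>

lemma pl_germ_slopes_eq_derivative:
  assumes germ: "pl_germ f l r x" and df: "(f has_real_derivative D) (at x)"
  shows "l = D \<and> r = D"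
proof -
  obtain e where e: "e > 0" "\<And>y. \<bar>y - x\<bar> < e \<Longrightarrow> f y = f x + (if y \<le> x then l else r) * (y - x)"
    using pl_germE[OF germ] by blast
  have d: "((\<lambda>y. f x + m * (y - x)) has_real_derivative m) (at x within S)" for m S
    by (auto intro!: derivative_eq_intros)
  have "(f has_real_derivative l) (at x within {..x})"
  proof (rule has_field_derivative_transform_within[OF d e(1)])
    show "f x + l * (y - x) = f y" if "y \<in> {..x}" "dist y x < e" for y
      using that e(2)[of y] by (auto simp: dist_real_def)
  qed simp
  then have "(f has_real_derivative l) (at_left x)"
    by (simp only: at_within_Iic_at_left)
  moreover have "(f has_real_derivative r) (at x within {x..})"
  proof (rule has_field_derivative_transform_within[OF d e(1)])
    show "f x + r * (y - x) = f y" if "y \<in> {x..}" "dist y x < e" for y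
      using that e(2)[of y] by (cases "y = x") (auto simp: dist_real_def)
  qed simp
  then have "(f has_real_derivative r) (at_right x)"
    by (simp only: at_within_Ici_at_right)
  moreover have "(f has_real_derivative D) (at x within S)" for S
    using df by (rule has_field_derivative_at_within)
  ultimately show ?thesis
    using has_field_derivative_unique trivial_limit_at_left_real trivial_limit_at_right_real
    by blast
qed

lemma constant_on_interval_of_derivative_zero:
  fixes f :: "real \<Rightarrow> real"
  assumes "\<And>x. x \<in> {a<..<b} \<Longrightarrow> (f has_real_derivative 0) (at x)"
  shows "\<exists>c. \<forall>x\<in>{a<..<b}. f x = c"
proof (rule has_field_derivative_zero_constant)
  show "(f has_real_derivative 0) (at x within {a<..<b})" if "x \<in> {a<..<b}" for x
    using assms[OF that] by (rule has_field_derivative_at_within)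
qed simp

text \<open>Each point has a punctured neighbourhood on which the map is differentiable, so the break points
  have no limit point and meet every compact interval in a finite set.  Away from the break points
  the derivative is locally constant, hence constant on every break-free interval, and the map is
  affine there.\<close>

lemma PL_deltaI:
  assumes hom: "homeomorphism UNIV UNIV f g" and M: "M > 1" and germs: "bounded_germs M f"
  shows "f \<in> carrier PL_delta"
proof -
  have isolated: "\<not> x islimpt break_points f" for x
  proof -
    obtain l r where "pl_germ f l r x" using bounded_germsD[OF germs] by blast
    then obtain e where "e > 0"
      and e: "\<And>y. x - e < y \<Longrightarrow> y < x \<Longrightarrow> (f has_real_derivative l) (at y)"
        "\<And>y. x < y \<Longrightarrow> y < x + e \<Longrightarrow> (f has_real_derivative r) (at y)"
      by (rule pl_germ_has_derivative_nearby) blast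
    have "y \<notin> break_points f" if "y \<noteq> x" "dist y x < e" for y
    proof (cases "y < x")
      case True
      then show ?thesis using e(1)[of y] that
        by (auto simp: break_points_def dist_real_def real_differentiable_def)
    next
      case False
      then show ?thesis using e(2)[of y] that
        by (auto simp: break_points_def dist_real_def real_differentiable_def)
    qed
    with \<open>e > 0\<close> show ?thesis by (auto simp: islimpt_approachable)
  qed
  have "finite (break_points f \<inter> {a..b})" for a b
    using finite_not_islimpt_in_compact[of "{a..b}" "break_points f"] isolated
    by (simp add: Int_commute)
  moreover have "\<exists>m c. \<forall>x\<in>{a<..<b}. f x = m * x + c" if "{a<..<b} \<inter> break_points f = {}" for a b
  proof -
    have df: "(f has_real_derivative deriv f x) (at x)" if "x \<in> {a<..<b}" for x
    proof -
      have "f differentiable (at x)"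
        using that \<open>{a<..<b} \<inter> break_points f = {}\<close> by (auto simp: break_points_def)
      then show ?thesis by (simp add: DERIV_deriv_iff_real_differentiable)
    qed
    have "(deriv f has_real_derivative 0) (at x)" if x: "x \<in> {a<..<b}" for x
    proof -
      define D where "D = deriv f x"
      have D: "(f has_real_derivative D) (at x)" using df[OF x] by (simp add: D_def)
      obtain l r where lr: "pl_germ f l r x" using bounded_germsD[OF germs] by blast
      then have "l = D \<and> r = D" using D by (rule pl_germ_slopes_eq_derivative)
      with lr have "pl_germ f D D x" by simp
      then obtain e where "e > 0"
        and e: "\<And>y. x - e < y \<Longrightarrow> y < x \<Longrightarrow> (f has_real_derivative D) (at y)"
          "\<And>y. x < y \<Longrightarrow> y < x + e \<Longrightarrow> (f has_real_derivative D) (at y)"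
        by (rule pl_germ_has_derivative_nearby) blast
      have const: "deriv f y = D" if "y \<in> {x - e<..<x + e}" for y
        using that e(1)[of y] e(2)[of y] D by (intro DERIV_imp_deriv) (cases y x rule: linorder_cases; auto)
      have x_in: "x \<in> {x - e<..<x + e}" using \<open>e > 0\<close> by simp
      show ?thesis
        by (rule has_field_derivative_transform_within_open[OF DERIV_const open_greaterThanLessThan x_in])
          (simp only: const)
    qed
    then have "\<exists>m. \<forall>x\<in>{a<..<b}. deriv f x = m"
      by (rule constant_on_interval_of_derivative_zero)
    then obtain m where m: "\<And>x. x \<in> {a<..<b} \<Longrightarrow> deriv f x = m" by blast
    have "((\<lambda>x. f x - m * x) has_real_derivative 0) (at x)"
      if "x \<in> {a<..<b}" for x
      using df[OF that] m[OF that] by (auto intro!: derivative_eq_intros)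
    then have "\<exists>c. \<forall>x\<in>{a<..<b}. f x - m * x = c"
      by (rule constant_on_interval_of_derivative_zero)
    then obtain c where "\<And>x. x \<in> {a<..<b} \<Longrightarrow> f x - m * x = c" by blast
    then have "\<forall>x\<in>{a<..<b}. f x = m * x + c" by (metis add.commute diff_add_cancel)
    then show ?thesis by blast
  qed
  moreover have "bounded_slopes (slopes f)"
    unfolding bounded_slopes_def
  proof (intro exI[of _ M] conjI M ballI)
    fix s assume "s \<in> slopes f"
    then obtain x where s: "s = deriv f x" and "f differentiable (at x)"
      by (auto simp: slopes_def break_points_def)
    then have df: "(f has_real_derivative s) (at x)"
      by (simp add: DERIV_deriv_iff_real_differentiable)
    obtain l r where "slope_within M l" "pl_germ f l r x" using bounded_germsD[OF germs] by blast
    with pl_germ_slopes_eq_derivative[OF _ df] have "slope_within M s" by blast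
    then show "1 / M < \<bar>s\<bar>" "\<bar>s\<bar> < M" by (simp_all add: slope_within_def)
  qed
  ultimately show ?thesis
    using hom by (auto simp: PL_delta_def pl_homeomorphism_def)
qed

text \<open>The affine formula holds on the open interval by definition and extends to the end points by
  continuity.  Written with increments, it holds at the break points that bound the interval too.\<close>

lemma affine_on_break_free_interval:
  assumes f: "pl_homeomorphism f" and "a < b" and free: "{a<..<b} \<inter> break_points f = {}"
  shows "\<exists>m\<in>slopes f. \<forall>y\<in>{a..b}. \<forall>z\<in>{a..b}. f y = f z + m * (y - z)"
proof -
  obtain m c where mc: "\<forall>x\<in>{a<..<b}. f x = m * x + c"
    using f free unfolding pl_homeomorphism_def by blast
  have "continuous_on UNIV f"
    using f by (auto simp: pl_homeomorphism_def homeomorphism_def)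
  then have "continuous_on {a..b} (\<lambda>y. f y - m * y)"
    by (auto intro!: continuous_intros intro: continuous_on_subset)
  then have cl: "f y - m * y = c" if "y \<in> {a..b}" for y
    using continuous_constant_on_closure[of "{a<..<b}" "\<lambda>y. f y - m * y" c y] mc that \<open>a < b\<close>
    by simp
  define x where "x = (a + b) / 2"
  have x: "x \<in> {a<..<b}" using \<open>a < b\<close> by (auto simp: x_def)
  have "((\<lambda>y. m * y + c) has_real_derivative m) (at x)" by (auto intro!: derivative_eq_intros)
  then have "(f has_real_derivative m) (at x)"
    using x mc by (intro has_field_derivative_transform_within_open[of _ m x "{a<..<b}" f]) auto
  then have "m = deriv f x" by (simp add: DERIV_imp_deriv)
  then have "m \<in> slopes f" using x free by (auto simp: slopes_def)
  moreover have "f y = f z + m * (y - z)" if "y \<in> {a..b}" "z \<in> {a..b}" for y z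
    using cl[OF that(1)] cl[OF that(2)] by (simp add: algebra_simps)
  ultimately show ?thesis by blast
qed

text \<open>Break points do not accumulate, so each point is an end point of two break-free intervals, one on
  either side; the slopes on these give the germ.\<close>

lemma PL_deltaD:
  assumes "f \<in> carrier PL_delta"
  obtains g M where "homeomorphism UNIV UNIV f g" "M > 1" "bounded_germs M f"
proof -
  have f: "pl_homeomorphism f" and "bounded_slopes (slopes f)"
    using assms by (auto simp: PL_delta_def)
  then obtain M where M: "M > 1" "\<And>s. s \<in> slopes f \<Longrightarrow> slope_within M s"
    by (auto simp: bounded_slopes_def slope_within_def)
  obtain g where g: "homeomorphism UNIV UNIV f g" using f by (auto simp: pl_homeomorphism_def)
  have "\<exists>l r. slope_within M l \<and> slope_within M r \<and> pl_germ f l r x" for x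
  proof -
    have "finite (break_points f \<inter> {x - 1..x + 1})" using f by (simp add: pl_homeomorphism_def)
    from finite_set_avoid[OF this, of x] obtain d where d: "d > 0"
      "\<And>y. y \<in> break_points f \<Longrightarrow> y \<in> {x - 1..x + 1} \<Longrightarrow> y \<noteq> x \<Longrightarrow> d \<le> dist x y"
      by blast
    define e where "e = min d 1"
    have e: "e > 0" using d by (simp add: e_def)
    have nb: "y \<notin> break_points f" if "y \<noteq> x" "\<bar>y - x\<bar> < e" for y
      using d(2)[of y] that by (auto simp: e_def dist_real_def abs_if split: if_splits)
    have "{x - e<..<x} \<inter> break_points f = {}" "{x<..<x + e} \<inter> break_points f = {}"
      using nb by (auto simp: abs_if)
    then obtain l r where
      l: "l \<in> slopes f" "\<forall>y\<in>{x - e..x}. \<forall>z\<in>{x - e..x}. f y = f z + l * (y - z)" and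
      r: "r \<in> slopes f" "\<forall>y\<in>{x..x + e}. \<forall>z\<in>{x..x + e}. f y = f z + r * (y - z)"
      using affine_on_break_free_interval[OF f, of "x - e" x]
        affine_on_break_free_interval[OF f, of x "x + e"] e by auto
    have "pl_germ f l r x"
    proof (rule pl_germI[OF e])
      fix y assume y: "\<bar>y - x\<bar> < e"
      show "f y = f x + (if y \<le> x then l else r) * (y - x)"
      proof (cases "y \<le> x")
        case True
        then have "y \<in> {x - e..x}" "x \<in> {x - e..x}" using y e by auto
        then have "f y = f x + l * (y - x)" using l(2) by blast
        with True show ?thesis by (simp only: if_True)
      next
        case False
        then have "y \<in> {x..x + e}" "x \<in> {x..x + e}" using y e by auto
        then have "f y = f x + r * (y - x)" using r(2) by blast
        with False show ?thesis by (simp only: if_False)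
      qed
    qed
    with M l(1) r(1) show ?thesis by blast
  qed
  then have "bounded_germs M f" by (simp add: bounded_germs_def)
  with g M(1) show thesis by (rule that)
qed

text \<open>By \<open>PL_deltaI\<close> and \<open>PL_deltaD\<close>, membership is equivalent to being a homeomorphism with bounded germ
  slopes, and both conditions are stable under composition and inversion.\<close>

lemma group_PL_delta: "group PL_delta"
proof (rule groupI)
  fix f h assume "f \<in> carrier PL_delta" "h \<in> carrier PL_delta"
  then obtain f' M h' N where
    f: "homeomorphism UNIV UNIV f f'" "M > 1" "bounded_germs M f" and
    h: "homeomorphism UNIV UNIV h h'" "N > 1" "bounded_germs N h"
    by (metis PL_deltaD)
  have "M * N > 1" using less_1_mult[OF f(2) h(2)] .
  moreover have "bounded_germs (M * N) (f \<circ> h)" using f h by (intro bounded_germs_compose) auto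
  ultimately show "f \<otimes>\<^bsub>PL_delta\<^esub> h \<in> carrier PL_delta"
    using PL_deltaI[OF homeomorphism_compose[OF h(1) f(1)]] by (simp add: PL_delta_def)
next
  have "pl_germ id 1 1 x" for x by (rule pl_germI[of 1]) auto
  then have "bounded_germs 2 id" by (auto simp: bounded_germs_def slope_within_def intro!: exI[of _ 1])
  then show "\<one>\<^bsub>PL_delta\<^esub> \<in> carrier PL_delta"
    using PL_deltaI[of id id 2] by (simp add: PL_delta_def homeomorphism_def)
next
  fix f assume "f \<in> carrier PL_delta"
  then obtain g M where f: "homeomorphism UNIV UNIV f g" "M > 1" "bounded_germs M f"
    by (rule PL_deltaD)
  then have "bounded_germs M g" by (intro bounded_germs_inverse[OF _ f(1)]) auto
  then have "g \<in> carrier PL_delta" using PL_deltaI f homeomorphism_sym by blast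
  moreover have "g \<otimes>\<^bsub>PL_delta\<^esub> f = \<one>\<^bsub>PL_delta\<^esub>"
    using f(1) by (auto simp: PL_delta_def homeomorphism_def)
  ultimately show "\<exists>g\<in>carrier PL_delta. g \<otimes>\<^bsub>PL_delta\<^esub> f = \<one>\<^bsub>PL_delta\<^esub>" by blast
qed (simp_all add: PL_delta_def comp_assoc)

section \<open>Metric consequences of slope bounds\<close>

lemma pl_germ_uminus:
  "pl_germ f l r x \<Longrightarrow> pl_germ (\<lambda>y. - f y) (- l) (- r) x"
  unfolding pl_germ_def by (erule eventually_mono) auto

text \<open>Near each point, the inequality holds for all intervals that contain the point; being additive
  under juxtaposition of intervals, it holds on all of \<open>[a, b]\<close> by bisection.\<close>

lemma increment_ge_of_germ_slopes_ge:
  assumes germs: "\<And>x. \<exists>l r. k \<le> l \<and> k \<le> r \<and> pl_germ f l r x" and "a \<le> b"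
  shows "k * (b - a) \<le> f b - f a"
  using \<open>a \<le> b\<close>
proof (induction rule: Bolzano)
  case (trans a b c)
  then show ?case by (simp add: algebra_simps)
next
  case (local x)
  obtain l r where lr: "k \<le> l" "k \<le> r" "pl_germ f l r x" using germs by blast
  obtain e where e: "e > 0" "\<And>y. \<bar>y - x\<bar> < e \<Longrightarrow> f y = f x + (if y \<le> x then l else r) * (y - x)"
    using pl_germE[OF lr(3)] by blast
  have "k * (b - a) \<le> f b - f a" if "a \<le> x" "x \<le> b" "b - a < e" for a b
  proof -
    have "f a = f x + l * (a - x)" using e(2)[of a] that by auto
    moreover have "f b = f x + r * (b - x)"
      using e(2)[of b] that by (cases "b = x") auto
    moreover have "k * (x - a) \<le> l * (x - a)" "k * (b - x) \<le> r * (b - x)"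
      using lr that by (auto intro!: mult_right_mono)
    ultimately show ?thesis by (simp add: algebra_simps)
  qed
  with e(1) show ?case by blast
qed

text \<open>The lower bound on increments, applied to \<open>f\<close> and to \<open>- f\<close>.\<close>

lemma bounded_germs_lipschitz:
  assumes "bounded_germs M f"
  shows "\<bar>f a - f b\<bar> \<le> M * \<bar>a - b\<bar>"
proof -
  have le: "\<bar>f b - f a\<bar> \<le> M * (b - a)" if "a \<le> b" for a b
  proof -
    have "\<exists>l r. - M \<le> l \<and> - M \<le> r \<and> pl_germ f l r x \<and>
      - M \<le> - l \<and> - M \<le> - r \<and> pl_germ (\<lambda>y. - f y) (- l) (- r) x" for x
    proof -
      obtain l r where lr: "slope_within M l" "slope_within M r" "pl_germ f l r x"
        using bounded_germsD[OF assms] by blast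
      then have "\<bar>l\<bar> < M" "\<bar>r\<bar> < M" by (simp_all add: slope_within_def)
      then show ?thesis
        using lr(3) pl_germ_uminus[OF lr(3)] by (intro exI[of _ l] exI[of _ r]) linarith
    qed
    then have "\<exists>l r. - M \<le> l \<and> - M \<le> r \<and> pl_germ f l r x"
      "\<exists>l r. - M \<le> l \<and> - M \<le> r \<and> pl_germ (\<lambda>y. - f y) l r x" for x by blast+
    note low = this
    from increment_ge_of_germ_slopes_ge[OF low(1) that] increment_ge_of_germ_slopes_ge[OF low(2) that]
    show ?thesis by (simp add: abs_le_iff)
  qed
  show ?thesis
  proof (cases "a \<le> b")
    case True
    with le[of a b] show ?thesis by (simp add: abs_minus_commute)
  next
    case False
    with le[of b a] show ?thesis by simp
  qed
qed

text \<open>The map and its inverse both have bounded slopes, so both are Lipschitz: the map is even bilipschitz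
  and surjective.\<close>

lemma PL_delta_quasi_isometry:
  assumes "f \<in> carrier PL_delta"
  shows "quasi_isometry f"
proof -
  obtain g M where hom: "homeomorphism UNIV UNIV f g" and M: "M > 1" and f: "bounded_germs M f"
    using assms by (rule PL_deltaD)
  have g: "bounded_germs M g" using M by (intro bounded_germs_inverse[OF _ hom f]) auto
  have inv: "f (g z) = z" "g (f x) = x" for x z using hom by (auto simp: homeomorphism_def)
  have up: "dist (f x) (f y) \<le> M * dist x y + M" for x y
    using bounded_germs_lipschitz[OF f, of x y] M by (simp add: dist_real_def)
  have low: "dist x y / M - M \<le> dist (f x) (f y)" for x y
  proof -
    have "dist x y \<le> M * dist (f x) (f y)"
      using bounded_germs_lipschitz[OF g, of "f x" "f y"] by (simp add: inv dist_real_def)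
    then have "dist x y / M \<le> dist (f x) (f y)" using M by (simp add: field_simps)
    then show ?thesis using M by linarith
  qed
  have "\<exists>x. dist z (f x) \<le> M" for z
    by (rule exI[of _ "g z"]) (use inv M in auto)
  with up low M show ?thesis
    by (auto simp: quasi_isometry_def quasi_isometry_const_def qi_embedding_const_def)
qed

text \<open>With slopes at least \<open>1 / M\<close> distances shrink at most by the factor \<open>1 / M\<close>.  This gives at once
  injectivity, a Lipschitz inverse and, since the values are then unbounded in both directions,
  surjectivity.\<close>

lemma PL_delta_of_positive_germs:
  assumes M: "M > 1" and germs: "\<And>x. \<exists>l r. 1 / M < l \<and> l < M \<and> 1 / M < r \<and> r < M \<and> pl_germ f l r x"
  shows "f \<in> carrier PL_delta"
proof -
  have bg: "bounded_germs M f"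
    unfolding bounded_germs_def
  proof
    fix x
    obtain l r where lr: "1 / M < l" "l < M" "1 / M < r" "r < M" "pl_germ f l r x"
      using germs by blast
    have "0 < 1 / M" using M by simp
    then have "0 < l" "0 < r" using lr by linarith+
    with lr have "slope_within M l" "slope_within M r" by (auto simp: slope_within_def)
    with lr show "\<exists>l r. slope_within M l \<and> slope_within M r \<and> pl_germ f l r x" by blast
  qed
  have cont: "continuous_on S f" for S
    using bounded_germs_continuous[OF bg] continuous_on_subset by blast
  have "1 / M * (b - a) \<le> f b - f a" if "a \<le> b" for a b
  proof (rule increment_ge_of_germ_slopes_ge[OF _ that])
    show "\<exists>l r. 1 / M \<le> l \<and> 1 / M \<le> r \<and> pl_germ f l r x" for x
      using germs[of x] by (meson less_imp_le)
  qed
  then have exp: "b - a \<le> M * (f b - f a)" if "a \<le> b" for a b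
    using that M by (simp add: field_simps)
  have expand: "\<bar>b - a\<bar> \<le> M * \<bar>f b - f a\<bar>" for a b
  proof (cases "a \<le> b")
    case True
    have "M * (f b - f a) \<le> M * \<bar>f b - f a\<bar>" using M by (intro mult_left_mono) auto
    with exp[OF True] True show ?thesis by linarith
  next
    case False
    have "M * (f a - f b) \<le> M * \<bar>f b - f a\<bar>" using M by (intro mult_left_mono) auto
    with exp[of b a] False show ?thesis by linarith
  qed
  have "\<exists>x. f x = z" for z
  proof -
    \<comment> \<open>Growth at rate at least \<open>1 / M\<close> forces \<open>f\<close> to reach \<open>z\<close> within distance \<open>N\<close> of the origin.\<close>
    define N where "N = M * \<bar>z - f 0\<bar>"
    have N: "N \<ge> 0" using M by (simp add: N_def)
    have "M * \<bar>z - f 0\<bar> \<le> M * (f N - f 0)" "M * \<bar>z - f 0\<bar> \<le> M * (f 0 - f (- N))"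
      using exp[of 0 N] exp[of "- N" 0] N by (auto simp: N_def)
    then have "f (- N) \<le> z" "z \<le> f N" using M by auto
    then show ?thesis using IVT'[of f "- N" z N] N cont by auto
  qed
  then obtain g where fg: "f (g z) = z" for z by metis
  have gf: "g (f x) = x" for x
    using expand[of "g (f x)" x] fg by simp
  have "M-lipschitz_on UNIV g"
    using expand[of "g _" "g _"] M by (intro lipschitz_onI) (auto simp: dist_real_def fg)
  then have "continuous_on UNIV g" by (rule lipschitz_on_continuous_on)
  with cont fg gf have "homeomorphism UNIV UNIV f g"
    by (intro homeomorphismI) auto
  then show ?thesis using M bg by (rule PL_deltaI)
qed

lemma PL_delta_uminus:
  assumes "f \<in> carrier PL_delta"
  shows "(\<lambda>x. - f x) \<in> carrier PL_delta"
proof -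
  interpret group PL_delta by (rule group_PL_delta)
  have "homeomorphism UNIV UNIV uminus (uminus :: real \<Rightarrow> real)"
    by (intro homeomorphismI continuous_intros) auto
  moreover have "pl_germ uminus (- 1) (- 1) x" for x by (rule pl_germI[of 1]) auto
  then have "bounded_germs 2 uminus"
    by (auto simp: bounded_germs_def slope_within_def intro!: exI[of _ "- 1"])
  ultimately have "uminus \<in> carrier PL_delta" using PL_deltaI[of uminus uminus 2] by simp
  then have "uminus \<otimes>\<^bsub>PL_delta\<^esub> f \<in> carrier PL_delta" using assms by (rule m_closed)
  then show ?thesis by (simp add: PL_delta_def comp_def)
qed

section \<open>Piecewise-linear interpolation on a grid\<close>

text \<open>The continuous function, affine on each cell of the grid, that takes the value \<open>X n\<close> at \<open>n * L\<close>.\<close>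

definition interp :: "(int \<Rightarrow> real) \<Rightarrow> real \<Rightarrow> real \<Rightarrow> real" where
  "interp X L t = (let n = \<lfloor>t / L\<rfloor> in X n + (X (n + 1) - X n) / L * (t - of_int n * L))"

lemma interp_on_cell:
  assumes L: "L > 0" and t: "of_int n * L \<le> t" "t \<le> of_int (n + 1) * L"
  shows "interp X L t = X n + (X (n + 1) - X n) / L * (t - of_int n * L)"
proof (cases "t = of_int (n + 1) * L")
  case True
  then have "t / L = of_int (n + 1)" using L by simp
  then have "\<lfloor>t / L\<rfloor> = n + 1" by (simp only: floor_of_int)
  then show ?thesis using True L by (simp add: interp_def Let_def field_simps)
next
  case False
  then have "\<lfloor>t / L\<rfloor> = n" using t L by (intro floor_unique) (auto simp: field_simps)
  then show ?thesis by (simp add: interp_def Let_def)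
qed

text \<open>The cells to the left and to the right of \<open>x\<close> are those with index \<open>\<lceil>x / L\<rceil> - 1\<close> and \<open>\<lfloor>x / L\<rfloor>\<close>;
  they are distinct exactly when \<open>x\<close> is a grid point.\<close>

lemma pl_germ_interp:
  assumes L: "L > 0"
  shows "\<exists>m n. pl_germ (interp X L) ((X (m + 1) - X m) / L) ((X (n + 1) - X n) / L) x"
proof -
  define n where "n = \<lfloor>x / L\<rfloor>"
  define m where "m = \<lceil>x / L\<rceil> - 1"
  have "of_int n \<le> x / L" "x / L < of_int n + 1" unfolding n_def by linarith+
  then have n: "of_int n * L \<le> x" "x < of_int (n + 1) * L" using L by (auto simp: field_simps)
  have "of_int m < x / L" "x / L \<le> of_int m + 1" unfolding m_def by linarith+
  then have m: "of_int m * L < x" "x \<le> of_int (m + 1) * L" using L by (auto simp: field_simps)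
  define e where "e = min (x - of_int m * L) (of_int (n + 1) * L - x)"
  have "pl_germ (interp X L) ((X (m + 1) - X m) / L) ((X (n + 1) - X n) / L) x"
  proof (rule pl_germI[of e])
    show "e > 0" using n m by (simp add: e_def)
    fix y assume y: "\<bar>y - x\<bar> < e"
    show "interp X L y = interp X L x
      + (if y \<le> x then (X (m + 1) - X m) / L else (X (n + 1) - X n) / L) * (y - x)"
    proof (cases "y \<le> x")
      case True
      have "interp X L y = X m + (X (m + 1) - X m) / L * (y - of_int m * L)"
        using y m True by (intro interp_on_cell L) (auto simp: e_def)
      moreover have "interp X L x = X m + (X (m + 1) - X m) / L * (x - of_int m * L)"
        using m by (intro interp_on_cell L) auto
      ultimately show ?thesis using True by (simp add: right_diff_distrib)
    next
      case False
      have "interp X L y = X n + (X (n + 1) - X n) / L * (y - of_int n * L)"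
        using y n False by (intro interp_on_cell L) (auto simp: e_def)
      moreover have "interp X L x = X n + (X (n + 1) - X n) / L * (x - of_int n * L)"
        using n by (intro interp_on_cell L) auto
      ultimately show ?thesis using False by (simp add: right_diff_distrib)
    qed
  qed
  then show ?thesis by blast
qed

lemma interp_PL_delta:
  assumes L: "L > 0" and p: "p > 0" and gap: "\<And>n. p \<le> X (n + 1) - X n" "\<And>n. X (n + 1) - X n \<le> q"
  shows "interp X L \<in> carrier PL_delta"
proof (rule PL_delta_of_positive_germs)
  \<comment> \<open>The slopes lie between \<open>p / L\<close> and \<open>q / L\<close>; the bound \<open>M\<close> exceeds \<open>1\<close>, \<open>L / p\<close> and \<open>q / L\<close>.\<close>
  define M where "M = 1 + L / p + q / L"
  have q: "q > 0" using gap[of 0] p by linarith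
  then show M: "M > 1" using L p by (simp add: M_def add_pos_pos)
  have slope: "1 / M < (X (n + 1) - X n) / L \<and> (X (n + 1) - X n) / L < M" for n
  proof
    have "L / p < M" using L p q by (simp add: M_def add_pos_pos)
    then have "1 / M < 1 / (L / p)" using L p M by (intro divide_strict_left_mono) auto
    also have "\<dots> = p / L" by simp
    also have "\<dots> \<le> (X (n + 1) - X n) / L" using gap L by (intro divide_right_mono) auto
    finally show "1 / M < (X (n + 1) - X n) / L" .
    have "(X (n + 1) - X n) / L \<le> q / L" using gap L by (intro divide_right_mono) auto
    also have "\<dots> < M" using L p by (simp add: M_def add_pos_pos)
    finally show "(X (n + 1) - X n) / L < M" .
  qed
  show "\<exists>l r. 1 / M < l \<and> l < M \<and> 1 / M < r \<and> r < M \<and> pl_germ (interp X L) l r x" for x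
    using pl_germ_interp[OF L, of X x] slope by blast
qed

section \<open>Quasi-isometries are monotone at large scale\<close>

text \<open>A coarsely Lipschitz map jumps by at most \<open>2 * C\<close> over a unit step, so it cannot cross the level
  \<open>v\<close> without coming within \<open>2 * C\<close> of it.\<close>

lemma coarse_intermediate_value:
  fixes f :: "real \<Rightarrow> real"
  assumes C: "C > 0" and f: "\<And>x y. \<bar>f x - f y\<bar> \<le> C * \<bar>x - y\<bar> + C"
    and "a \<le> b" and v: "f a \<le> v \<and> v \<le> f b \<or> f b \<le> v \<and> v \<le> f a"
  shows "\<exists>t\<in>{a..b}. \<bar>f t - v\<bar> \<le> 2 * C"
proof (rule ccontr)
  assume "\<not> ?thesis"
  then have avoid: "2 * C < \<bar>f t - v\<bar>" if "a \<le> t" "t \<le> b" for t using that by force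
  \<comment> \<open>Avoiding the band around \<open>v\<close>, the map stays on one side of it over short intervals, hence over all.\<close>
  have "a \<le> s \<and> t \<le> b \<longrightarrow> (f s \<le> v \<longleftrightarrow> f t \<le> v)" if "s \<le> t" for s t
    using that
  proof (induction rule: Bolzano)
    case (trans s t u)
    then show ?case by auto
  next
    case (local x)
    have "f s \<le> v \<longleftrightarrow> f t \<le> v" if "s \<le> x" "x \<le> t" "t - s < 1" "a \<le> s" "t \<le> b" for s t
    proof -
      have "C * \<bar>s - t\<bar> \<le> C * 1" using that C by (intro mult_left_mono) auto
      then have "\<bar>f s - f t\<bar> \<le> 2 * C" using f[of s t] by linarith
      then show ?thesis using avoid[of s] avoid[of t] that C by linarith
    qed
    then show ?case by (intro exI[of _ 1]) auto
  qed
  then have "f a \<le> v \<longleftrightarrow> f b \<le> v" using \<open>a \<le> b\<close> by blast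
  then show False using v avoid[of a] avoid[of b] \<open>a \<le> b\<close> C by auto
qed

text \<open>No change of direction at large scale.  Points at distance at least \<open>4 * C\<^sup>2\<close> have images at distance
  at least \<open>4 * C - C = 3 * C\<close>.  If \<open>f\<close> turned back at \<open>b\<close>, then one of the end values \<open>f a\<close>, \<open>f c\<close>
  would lie between the values at the ends of the opposite interval, and would be attained there up
  to \<open>2 * C\<close>, at a point too far away for that.\<close>

lemma qi_embedding_between:
  fixes f :: "real \<Rightarrow> real"
  assumes qi: "qi_embedding_const C f" and ab: "4 * C\<^sup>2 \<le> b - a" and bc: "4 * C\<^sup>2 \<le> c - b"
  shows "f a < f b \<longleftrightarrow> f b < f c"
proof -
  have C: "C > 1" and low: "\<And>x y. \<bar>x - y\<bar> / C - C \<le> \<bar>f x - f y\<bar>"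
    and up: "\<And>x y. \<bar>f x - f y\<bar> \<le> C * \<bar>x - y\<bar> + C"
    using qi by (auto simp: qi_embedding_const_def dist_real_def)
  have "0 < C\<^sup>2" using C by simp
  then have order: "a < b" "b < c" using ab bc by linarith+
  have far: "3 * C \<le> \<bar>f x - f y\<bar>" if "4 * C\<^sup>2 \<le> \<bar>x - y\<bar>" for x y
  proof -
    have "4 * C \<le> \<bar>x - y\<bar> / C" using that C by (simp add: field_simps power2_eq_square)
    then show ?thesis using low[of x y] by linarith
  qed
  have "\<not> (f a \<le> f c \<and> f c \<le> f b \<or> f b \<le> f c \<and> f c \<le> f a)"
  proof
    assume "f a \<le> f c \<and> f c \<le> f b \<or> f b \<le> f c \<and> f c \<le> f a"
    then obtain t where t: "t \<in> {a..b}" "\<bar>f t - f c\<bar> \<le> 2 * C"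
      using coarse_intermediate_value[of C f a b "f c"] C up order by auto
    from t(1) have "4 * C\<^sup>2 \<le> \<bar>t - c\<bar>" using bc unfolding atLeastAtMost_iff by linarith
    then show False using t(2) far[of t c] C by linarith
  qed
  moreover have "\<not> (f b \<le> f a \<and> f a \<le> f c \<or> f c \<le> f a \<and> f a \<le> f b)"
  proof
    assume "f b \<le> f a \<and> f a \<le> f c \<or> f c \<le> f a \<and> f a \<le> f b"
    then obtain t where t: "t \<in> {b..c}" "\<bar>f t - f a\<bar> \<le> 2 * C"
      using coarse_intermediate_value[of C f b c "f a"] C up order by auto
    from t(1) have "4 * C\<^sup>2 \<le> \<bar>t - a\<bar>" using ab unfolding atLeastAtMost_iff by linarith
    then show False using t(2) far[of t a] C by linarith
  qed
  ultimately show ?thesis by linarith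
qed

section \<open>Every quasi-isometry is close to a piecewise-linear homeomorphism\<close>

lemma int_step_invariant:
  fixes P :: "int \<Rightarrow> bool"
  assumes "\<And>n. P n \<longleftrightarrow> P (n + 1)"
  shows "P n \<longleftrightarrow> P 0"
proof (induction n rule: int_induct[where k = 0])
  case (step1 i)
  then show ?case using assms[of i] by simp
next
  case (step2 i)
  then show ?case using assms[of "i - 1"] by simp
qed simp

text \<open>The interpolant of the values on the grid is close to \<open>f\<close>: within one cell, neither function moves
  by more than \<open>C * L + C\<close> from its common value at the left grid point.\<close>

lemma PL_delta_near_increasing_on_grid:
  fixes f :: "real \<Rightarrow> real"
  assumes C: "C > 0" and f: "\<And>x y. \<bar>f x - f y\<bar> \<le> C * \<bar>x - y\<bar> + C"
    and L: "L > 0" and p: "p > 0" and gap: "\<And>n::int. p \<le> f (of_int (n + 1) * L) - f (of_int n * L)"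
  shows "\<exists>g\<in>carrier PL_delta. \<exists>K. \<forall>x. \<bar>f x - g x\<bar> \<le> K"
proof -
  define X where "X n = f (of_int n * L)" for n
  define q where "q = C * L + C"
  have q: "\<bar>X (n + 1) - X n\<bar> \<le> q" for n
    using f[of "of_int (n + 1) * L" "of_int n * L"] L
    by (simp add: X_def q_def algebra_simps)
  have "interp X L \<in> carrier PL_delta"
  proof (rule interp_PL_delta[OF L p])
    show "p \<le> X (n + 1) - X n" "X (n + 1) - X n \<le> q" for n
      using gap[of n] q[of n] by (auto simp: X_def)
  qed
  moreover have "\<bar>f t - interp X L t\<bar> \<le> 2 * q" for t
  proof -
    define n where "n = \<lfloor>t / L\<rfloor>"
    have "of_int n \<le> t / L" "t / L < of_int n + 1" unfolding n_def by linarith+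
    then have n: "of_int n * L \<le> t" "t < of_int (n + 1) * L" using L by (auto simp: field_simps)
    then have d: "0 \<le> t - of_int n * L" "t - of_int n * L \<le> L" by (auto simp: algebra_simps)
    have "C * \<bar>t - of_int n * L\<bar> \<le> C * L" using d C by (intro mult_left_mono) auto
    then have 1: "\<bar>f t - X n\<bar> \<le> q"
      using f[of t "of_int n * L"] by (simp add: X_def q_def)
    have "interp X L t - X n = (X (n + 1) - X n) * ((t - of_int n * L) / L)"
      using interp_on_cell[OF L n(1), of X] n(2) by simp
    then have "\<bar>interp X L t - X n\<bar> = \<bar>X (n + 1) - X n\<bar> * ((t - of_int n * L) / L)"
      using d(1) L by (simp add: abs_mult)
    also have "\<dots> \<le> \<bar>X (n + 1) - X n\<bar> * 1"
      using d L by (intro mult_left_mono) auto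
    also have "\<dots> \<le> q" using q[of n] by simp
    finally have "\<bar>interp X L t - X n\<bar> \<le> q" .
    with 1 show ?thesis by linarith
  qed
  ultimately show ?thesis by blast
qed

text \<open>On a grid of width \<open>4 * C\<^sup>2\<close> the values are strictly monotone with steps bounded below, so their
  interpolant is a homeomorphism with bounded slopes.  The decreasing case is reduced to the
  increasing one by passing to \<open>- f\<close>.\<close>

lemma PL_delta_near_quasi_isometry:
  fixes f :: "real \<Rightarrow> real"
  assumes "quasi_isometry f"
  shows "\<exists>g\<in>carrier PL_delta. \<exists>K. \<forall>x. \<bar>f x - g x\<bar> \<le> K"
proof -
  obtain C where qi: "qi_embedding_const C f"
    using assms by (auto simp: quasi_isometry_def quasi_isometry_const_def)
  then have C: "C > 1" and low: "\<And>x y. \<bar>x - y\<bar> / C - C \<le> \<bar>f x - f y\<bar>"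
    and up: "\<And>x y. \<bar>f x - f y\<bar> \<le> C * \<bar>x - y\<bar> + C"
    by (auto simp: qi_embedding_const_def dist_real_def)
  define L where "L = 4 * C\<^sup>2"
  define X where "X n = f (of_int n * L)" for n :: int
  have L: "L > 0" using C by (simp add: L_def)
  have cell: "of_int (n + 1) * L - of_int n * L = L" for n :: int by (simp add: algebra_simps)
  have "L / C = 4 * C" using C by (simp add: L_def power2_eq_square)
  then have far: "3 * C \<le> \<bar>X (n + 1) - X n\<bar>" for n
    using low[of "of_int (n + 1) * L" "of_int n * L"] cell[of n] L by (simp add: X_def)
  have "X n < X (n + 1) \<longleftrightarrow> X (n + 1) < X (n + 1 + 1)" for n
    unfolding X_def by (rule qi_embedding_between[OF qi]) (simp_all only: cell L_def[symmetric] order_refl)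
  then have mono: "X n < X (n + 1) \<longleftrightarrow> X 0 < X (0 + 1)" for n
    by (rule int_step_invariant[where P = "\<lambda>n. X n < X (n + 1)"])
  show ?thesis
  proof (cases "X 0 < X (0 + 1)")
    case True
    have "3 * C \<le> X (n + 1) - X n" for n
      using far[of n] mono[of n] True by linarith
    then show ?thesis
      using C up L by (intro PL_delta_near_increasing_on_grid[of C f L "3 * C"]) (auto simp: X_def)
  next
    case False
    have "3 * C \<le> - X (n + 1) - (- X n)" for n
      using far[of n] mono[of n] False by linarith
    moreover have "\<bar>- f x - (- f y)\<bar> \<le> C * \<bar>x - y\<bar> + C" for x y
      using up[of x y] by linarith
    ultimately obtain g K where g: "g \<in> carrier PL_delta" "\<And>x. \<bar>- f x - g x\<bar> \<le> K"
      using C L PL_delta_near_increasing_on_grid[of C "\<lambda>x. - f x" L "3 * C"]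
      by (auto simp: X_def)
    have "\<bar>f x - (- g x)\<bar> \<le> K" for x using g(2)[of x] by linarith
    then show ?thesis by (intro bexI[OF _ PL_delta_uminus[OF g(1)]] exI allI)
  qed
qed

lemma qi_class_image_PL_delta:
  "qi_class ` carrier PL_delta = carrier (QI :: (real \<Rightarrow> real) set monoid)"
proof
  show "qi_class ` carrier PL_delta \<subseteq> carrier (QI :: (real \<Rightarrow> real) set monoid)"
    by (auto simp: QI_def qi_class_def PL_delta_quasi_isometry intro!: quotientI)
  show "carrier (QI :: (real \<Rightarrow> real) set monoid) \<subseteq> qi_class ` carrier PL_delta"
  proof
    fix A :: "(real \<Rightarrow> real) set" assume "A \<in> carrier QI"
    then obtain f where f: "quasi_isometry f" and A: "A = qi_class f"
      by (auto simp: QI_def qi_class_def elim: quotientE)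
    obtain g K where g: "g \<in> carrier PL_delta" "\<And>x. \<bar>f x - g x\<bar> \<le> K"
      using PL_delta_near_quasi_isometry[OF f] by blast
    then have "(f, g) \<in> qi_rel"
      using f PL_delta_quasi_isometry[OF g(1)] by (auto simp: qi_rel_def dist_real_def)
    then have "qi_class f = qi_class g"
      unfolding qi_class_def by (rule equiv_class_eq[OF equiv_qi_rel])
    with A g(1) show "A \<in> qi_class ` carrier PL_delta" by blast
  qed
qed

text \<open>The quotient is a group because it is the image of a group under a map that respects products:
  a quasi-inverse of a quasi-isometry is the inverse of a piecewise-linear representative.\<close>

theorem theorem1p2:
  shows "group PL_delta \<and> group (QI :: (real \<Rightarrow> real) set monoid) \<and>
    qi_class \<in> hom PL_delta (QI :: (real \<Rightarrow> real) set monoid) \<and>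
    qi_class ` carrier PL_delta = carrier (QI :: (real \<Rightarrow> real) set monoid)"
proof -
  interpret PL: group PL_delta by (rule group_PL_delta)
  have hom: "qi_class \<in> hom PL_delta (QI :: (real \<Rightarrow> real) set monoid)"
  proof (rule homI)
    fix f h assume "f \<in> carrier PL_delta" "h \<in> carrier PL_delta"
    then show "qi_class (f \<otimes>\<^bsub>PL_delta\<^esub> h) = qi_class f \<otimes>\<^bsub>QI\<^esub> qi_class h"
      using QI_mult_class[OF PL_delta_quasi_isometry PL_delta_quasi_isometry]
      by (simp add: PL_delta_def)
  qed (use qi_class_image_PL_delta in blast)
  moreover have "QI\<lparr>carrier := qi_class ` carrier PL_delta, one := qi_class \<one>\<^bsub>PL_delta\<^esub>\<rparr>
      = (QI :: (real \<Rightarrow> real) set monoid)"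
    by (simp only: qi_class_image_PL_delta) (simp add: QI_def PL_delta_def)
  then have "group (QI :: (real \<Rightarrow> real) set monoid)"
    using PL.hom_imp_img_group[OF hom] by simp
  ultimately show ?thesis
    using group_PL_delta qi_class_image_PL_delta by blast
qed

end
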